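(* Let $p, q$ be distinct odd primes. Then $$Z(pq)\equiv 2(2-q)\left(1-\frac{1}{q^{3}}\right)B_{p-3}\pmod{p}.$$
   Context: For a positive integer $n$, let $\mathcal{P}_n$ denote the set of positive integers which are prime to $n$, and define the rational number $$Z(n)=\sum_{\substack{i+j+k=n\\ i,j,k\in\mathcal{P}_n}}\frac{1}{ijk},$$ the sum being over ordered triples $(i,j,k)$. The Bernoulli numbers $B_k$ are defined by $B_0=1$ and the recursion $\sum_{i=0}^{n}\binom{n+1}{i}B_i=0$ for $n\ge 1$. A congruence modulo $p$ between rational numbers whose denominators are prime to $p$ means that the numerator of their difference, in lowest terms, is divisible by $p$. *)

theory Defs
  imports Complex_Main "HOL-Computational_Algebra.Primes"
begin

definition pos_coprime :: "nat \<Rightarrow> nat set" where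
  "pos_coprime n = {m. 0 < m \<and> coprime m n}"

definition Z :: "nat \<Rightarrow> rat" where
  "Z n = (\<Sum>(i, j, k) \<in> {(i, j, k). i + j + k = n \<and>
            i \<in> pos_coprime n \<and> j \<in> pos_coprime n \<and> k \<in> pos_coprime n}.
          1 / (of_nat i * of_nat j * of_nat k))"

(* The index set is finite, so the sum is not the default value 0 of an infinite sum. *)
lemma finite_Z_index:
  "finite {(i, j, k). i + j + k = n \<and>
     i \<in> pos_coprime n \<and> j \<in> pos_coprime n \<and> k \<in> pos_coprime n}"
  by (rule finite_subset[of _ "{..n} \<times> {..n} \<times> {..n}"]) auto

(* The recursion (\<Sum>i\<le>n. (n+1 choose i) * B i) = 0 for n \<ge> 1, solved for its last
   term (n+1) * B n; see bernoulli_recursion. In particular B 1 = -1/2. *)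
fun bernoulli :: "nat \<Rightarrow> rat" where
  "bernoulli n = (if n = 0 then 1
     else - (\<Sum>i<n. of_nat ((n + 1) choose i) * bernoulli i) / of_nat (n + 1))"

declare bernoulli.simps [simp del]

lemma bernoulli_0: "bernoulli 0 = 1"
  by (simp add: bernoulli.simps)

lemma bernoulli_recursion:
  assumes "n \<ge> 1"
  shows "(\<Sum>i=0..n. of_nat ((n + 1) choose i) * bernoulli i) = 0"
proof -
  have "(\<Sum>i=0..n. of_nat ((n + 1) choose i) * bernoulli i)
      = (\<Sum>i<n. of_nat ((n + 1) choose i) * bernoulli i) + of_nat (n + 1) * bernoulli n"
    by (simp add: atLeast0AtMost flip: lessThan_Suc_atMost)
  also have "of_nat (n + 1) * bernoulli n = - (\<Sum>i<n. of_nat ((n + 1) choose i) * bernoulli i)"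
    using assms by (subst bernoulli.simps) (simp del: of_nat_Suc)
  finally show ?thesis
    by simp
qed

(* quotient_of x is the pair (numerator, denominator) of x in lowest terms, with
   positive denominator. The first two conjuncts say that the congruence is meaningful. *)
definition rat_cong :: "rat \<Rightarrow> rat \<Rightarrow> nat \<Rightarrow> bool" where
  "rat_cong x y m \<longleftrightarrow>
     coprime (snd (quotient_of x)) (int m) \<and> coprime (snd (quotient_of y)) (int m) \<and>
     int m dvd fst (quotient_of (x - y))"

end

theory Submission
  imports Defs "HOL-Number_Theory.Number_Theory"
begin

text \<open>
  Write \<open>1/x\<close> for the inverse modulo \<open>p\<close>, extended by \<open>0\<close> to the multiples of \<open>p\<close> (the function
  \<open>pinv\<close>), and let \<open>H s\<close> be the sum of the inverses of the numbers below \<open>s\<close> (\<open>pharm\<close>). Two sums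
  modulo \<open>p\<close> govern the problem:
  \<open>U = (\<Sum>r<p. H r / r\<^sup>2)\<close> (\<open>hsum\<close>) and \<open>F = (\<Sum>t<p. (q t div p) / (q t)\<^sup>3)\<close> (\<open>floor_sum q\<close>).

  For a triple with \<open>i + j + k = n\<close>, where \<open>p\<close> divides \<open>n\<close>, one has \<open>1/i = - 1/(j + k)\<close>. Splitting
  \<open>1/(jk)\<close> into partial fractions and summing over \<open>j + k = s\<close> gives
  \<open>(1/s) * (\<Sum>j + k = s. 1/(jk)) = 2 H s / s\<^sup>2 - 2 (s div p) / s\<^sup>3\<close> (\<open>pinv_mult_pconv\<close>), where the
  second term accounts for the multiples of \<open>p\<close> among the \<open>j\<close> and \<open>k\<close>. As \<open>H\<close> has period \<open>p\<close>, this
  evaluates three sums of \<open>1/(ijk)\<close> over triples with sum \<open>p q\<close>: over all triples it is \<open>- 2 q U\<close>,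
  over those with \<open>q\<close> dividing \<open>i\<close> it is \<open>- 2 U + 2 F\<close>, and over those with all entries divisible
  by \<open>q\<close> it is \<open>- 2 U / q\<^sup>3\<close>. Inclusion and exclusion (\<open>sum_triples_coprime\<close>) then give
  \<open>Z (p q) = (6 - 2 q - 4 / q\<^sup>3) U - 6 F\<close> modulo \<open>p\<close>.

  It remains to see that \<open>U = B\<close> and \<open>3 F = (1 - 1 / q\<^sup>2) B\<close> for \<open>B = bernoulli (p - 3)\<close>. Both come
  from Faulhaber's formula for power sums. For \<open>U\<close>, it expands \<open>H\<close> as a polynomial with Bernoulli
  coefficients, of which summation over all residues selects one (\<open>hsum_bernoulli\<close>). The claim on
  \<open>F\<close> is a case of Voronoi's congruence, obtained by expanding \<open>(q t) ^ (p - 3)\<close> modulo \<open>p\<^sup>2\<close>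
  (\<open>floor_sum_bernoulli\<close>). Inserting both values yields \<open>2 (2 - q) (1 - 1 / q\<^sup>3) B\<close>.

  The congruences are proved between integers, with the Bernoulli numbers replaced by their
  multiples by a common denominator prime to \<open>p\<close>; rational numbers reappear only at the end.
\<close>

section \<open>Power sums and Bernoulli numbers\<close>

lemma sum_bernoulli_binomial:
  "(\<Sum>k\<le>m. of_nat (Suc m choose k) * bernoulli k) = (if m = 0 then 1 else 0)"
  using bernoulli_recursion[of m] by (simp add: bernoulli_0 atLeast0AtMost)

text \<open>Faulhaber's formula. The right-hand side is a polynomial in \<open>n\<close> that vanishes at \<open>0\<close>, so
it suffices to compare increments. In the increment of the right-hand side the coefficient of
\<open>n ^ j\<close> is \<open>(m + 1) choose j\<close> times the sum defining the Bernoulli recursion at \<open>m - j\<close>, which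
vanishes unless \<open>j = m\<close>.\<close>

lemma power_sum_bernoulli:
  "of_nat (Suc m) * (\<Sum>i<n. of_nat i ^ m) =
     (\<Sum>k\<le>m. of_nat (Suc m choose k) * bernoulli k * of_nat n ^ (Suc m - k))"
proof (induction n)
  case 0
  then show ?case by (auto intro!: sum.neutral)
next
  case (Suc n)
  let ?x = "of_nat n :: rat"
  have power_Suc_diff: "(?x + 1) ^ (Suc m - k) - ?x ^ (Suc m - k) =
      (\<Sum>j\<le>m - k. of_nat (Suc m - k choose j) * ?x ^ j)" if "k \<le> m" for k
    using that binomial_ring[of ?x 1 "Suc m - k"] by (simp add: Suc_diff_le)
  have trinomial: "(Suc m choose k) * (Suc m - k choose j) = (Suc m choose j) * (Suc m - j choose k)"
    if "k + j \<le> m" for k j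
  proof -
    have "(Suc m choose (k + j)) * ((k + j) choose k) = (Suc m choose k) * (Suc m - k choose j)"
      using that choose_mult[of k "k + j" "Suc m"] by simp
    moreover have "(Suc m choose (k + j)) * ((k + j) choose j) = (Suc m choose j) * (Suc m - j choose k)"
      using that choose_mult[of j "k + j" "Suc m"] by simp
    moreover have "(k + j) choose k = (k + j) choose j"
      using binomial_symmetric[of k "k + j"] by simp
    ultimately show ?thesis by simp
  qed
  have "(\<Sum>k\<le>m. of_nat (Suc m choose k) * bernoulli k * of_nat (Suc n) ^ (Suc m - k)) -
      (\<Sum>k\<le>m. of_nat (Suc m choose k) * bernoulli k * ?x ^ (Suc m - k)) =
      (\<Sum>k\<le>m. \<Sum>j\<le>m - k. of_nat (Suc m choose k) * bernoulli k * (of_nat (Suc m - k choose j) * ?x ^ j))"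
    by (simp add: sum_subtractf[symmetric] right_diff_distrib[symmetric] sum_distrib_left[symmetric]
        power_Suc_diff add.commute[of 1] del: binomial_Suc_Suc)
  also have "\<dots> = (\<Sum>j\<le>m. \<Sum>k\<le>m - j. of_nat (Suc m choose k) * bernoulli k * (of_nat (Suc m - k choose j) * ?x ^ j))"
    by (auto simp: sum.Sigma intro!: sum.reindex_bij_witness[of _ "\<lambda>(a, b). (b, a)" "\<lambda>(a, b). (b, a)"])
  also have "\<dots> = (\<Sum>j\<le>m. of_nat (Suc m choose j) * ?x ^ j *
      (\<Sum>k\<le>m - j. of_nat (Suc (m - j) choose k) * bernoulli k))"
  proof (rule sum.cong)
    fix j assume j: "j \<in> {..m}"
    have "of_nat (Suc m choose k) * bernoulli k * (of_nat (Suc m - k choose j) * ?x ^ j) =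
        of_nat (Suc m choose j) * ?x ^ j * (of_nat (Suc (m - j) choose k) * bernoulli k)"
      if "k \<le> m - j" for k
    proof -
      have "of_nat (Suc m choose k) * (of_nat (Suc m - k choose j) :: rat) =
          of_nat (Suc m choose j) * of_nat (Suc (m - j) choose k)"
        using trinomial[of k j] that j unfolding of_nat_mult[symmetric]
        by (simp add: Suc_diff_le del: binomial_Suc_Suc)
      then show ?thesis by (simp add: mult_ac del: binomial_Suc_Suc)
    qed
    then show "(\<Sum>k\<le>m - j. of_nat (Suc m choose k) * bernoulli k * (of_nat (Suc m - k choose j) * ?x ^ j)) =
        of_nat (Suc m choose j) * ?x ^ j * (\<Sum>k\<le>m - j. of_nat (Suc (m - j) choose k) * bernoulli k)"
      unfolding sum_distrib_left by (intro sum.cong) auto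
  qed simp
  also have "\<dots> = (\<Sum>j\<le>m. if j = m then of_nat (Suc m) * ?x ^ m else 0)"
    by (intro sum.cong) (auto simp: sum_bernoulli_binomial simp del: binomial_Suc_Suc)
  also have "\<dots> = of_nat (Suc m) * ?x ^ m"
    by simp
  finally show ?case
    using Suc.IH by (simp add: distrib_left del: binomial_Suc_Suc of_nat_Suc)
qed

text \<open>The recursion divides only by \<open>1, \<dots>, k + 1\<close> on the way to \<open>bernoulli k\<close>, so no denominator
below index \<open>p - 1\<close> involves \<open>p\<close>. A single multiplier \<open>D\<close> for all of them turns every later
statement about Bernoulli numbers into a congruence between integers.\<close>

lemma bernoulli_common_denominator:
  assumes "prime p"
  shows "\<exists>D \<beta>. coprime D (int p) \<and> (\<forall>k<p - 1. of_int D * bernoulli k = of_int (\<beta> k))"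
proof -
  have "\<exists>D. coprime D (int p) \<and> (\<forall>k<K. of_int D * bernoulli k \<in> \<int>)" if "K \<le> p - 1" for K
    using that
  proof (induction K)
    case 0
    show ?case by (rule exI[of _ 1]) simp
  next
    case (Suc K)
    then obtain D where D: "coprime D (int p)" "\<And>k. k < K \<Longrightarrow> of_int D * bernoulli k \<in> \<int>"
      by auto
    have "\<not> p dvd K + 1"
      using Suc.prems prime_gt_0_nat[OF assms] by (auto dest!: dvd_imp_le)
    then have "coprime (K + 1) p"
      using prime_imp_coprime[OF assms] coprime_commute by blast
    then have "coprime (D * int (K + 1)) (int p)"
      using D(1) by (metis coprime_int_iff coprime_mult_left_iff)
    moreover have "of_int (D * int (K + 1)) * bernoulli k \<in> \<int>" if "k < Suc K" for k
    proof (cases "k < K")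
      case True
      have "of_int (int (K + 1)) * (of_int D * bernoulli k) \<in> \<int>"
        using D(2)[OF True] by (rule Ints_mult[OF Ints_of_int])
      moreover have "of_int (int (K + 1)) * (of_int D * bernoulli k) =
          of_int (D * int (K + 1)) * bernoulli k"
        by (simp only: of_int_mult mult_ac)
      ultimately show ?thesis by (simp only:)
    next
      case False
      then have "k = K" using that by simp
      show ?thesis
      proof (cases "K = 0")
        case True
        then show ?thesis using \<open>k = K\<close> by (simp add: bernoulli_0)
      next
        case False
        have "of_int (D * int (K + 1)) * bernoulli K = of_int D * (of_nat (K + 1) * bernoulli K)"
          by (simp del: of_nat_Suc)
        also have "of_nat (K + 1) * bernoulli K = - (\<Sum>i<K. of_nat ((K + 1) choose i) * bernoulli i)"
          using False by (subst bernoulli.simps) (simp del: of_nat_Suc)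
        also have "of_int D * - (\<Sum>i<K. of_nat ((K + 1) choose i) * bernoulli i) =
            - (\<Sum>i<K. of_nat ((K + 1) choose i) * (of_int D * bernoulli i))"
          by (simp only: sum_distrib_left mult_minus_right mult.left_commute)
        also have "\<dots> \<in> \<int>"
        proof (intro Ints_minus Ints_sum Ints_mult[OF Ints_of_nat])
          fix i assume "i \<in> {..<K}"
          then show "of_int D * bernoulli i \<in> \<int>"
            by (intro D(2)) simp
        qed
        finally show ?thesis unfolding \<open>k = K\<close> .
      qed
    qed
    ultimately show ?case by blast
  qed
  from this[of "p - 1"] obtain D where "coprime D (int p)"
    "\<forall>k<p - 1. of_int D * bernoulli k \<in> \<int>" by auto
  then have "\<forall>k<p - 1. of_int D * bernoulli k = of_int \<lfloor>of_int D * bernoulli k\<rfloor>"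
    by (simp add: of_int_floor_cancel)
  then show ?thesis
    using \<open>coprime D (int p)\<close> by (intro exI[of _ D] exI[of _ "\<lambda>k. \<lfloor>of_int D * bernoulli k\<rfloor>"]) simp
qed

section \<open>Inverses modulo an odd prime\<close>

lemma cong_imp_add_mult:
  fixes a b m :: int
  assumes "[a = b] (mod m)"
  obtains k where "a = b + m * k"
  using cong_sym[OF assms] unfolding cong_iff_lin by blast

locale odd_prime =
  fixes p :: nat
  assumes prime_p: "prime p" and odd_p: "odd p"
begin

lemma p_ge_3: "p \<ge> 3"
  using prime_p odd_p prime_ge_2_nat[of p] by (cases "p = 2") auto

text \<open>The inverse modulo \<open>p\<close>, by Fermat. Taking the power \<open>p - 2\<close> gives a multiplicative function
with value \<open>0\<close> (modulo \<open>p\<close>) at the multiples of \<open>p\<close>, so that sums over indices prime to \<open>p\<close> may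
be extended over all indices.\<close>

definition pinv :: "nat \<Rightarrow> int" where
  "pinv i = int i ^ (p - 2)"

lemma pinv_0 [simp]: "pinv 0 = 0"
  using p_ge_3 by (simp add: pinv_def)

lemma pinv_mult: "pinv (a * b) = pinv a * pinv b"
  by (simp add: pinv_def power_mult_distrib)

lemma pinv_cong:
  assumes "[a = b] (mod p)"
  shows "[pinv a = pinv b] (mod int p)"
  using assms unfolding pinv_def by (intro cong_pow) (simp add: cong_int_iff)

lemma pinv_dvd: "p dvd a \<Longrightarrow> [pinv a = 0] (mod int p)"
  using pinv_cong[of a 0] by (simp add: cong_0_iff)

lemma pinv_inverse:
  assumes "\<not> p dvd a"
  shows "[int a * pinv a = 1] (mod int p)"
proof -
  have "int a * pinv a = int (a ^ (p - 1))"
    using p_ge_3 power_Suc[of "int a" "p - 2"] by (simp add: pinv_def Suc_diff_Suc numeral_2_eq_2)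
  then show ?thesis
    using fermat_theorem[OF prime_p assms] by (metis cong_int_iff of_nat_1)
qed

lemma pinv_neg:
  assumes "p dvd a + b"
  shows "[pinv a = - pinv b] (mod int p)"
proof -
  have "[int a = - int b] (mod int p)"
    using assms by (simp add: cong_iff_dvd_diff flip: of_nat_add)
  moreover have "odd (p - 2)"
    using odd_p p_ge_3 by simp
  ultimately show ?thesis
    unfolding pinv_def by (metis cong_pow power_minus_odd)
qed

lemma power_cong_exponent:
  assumes "[e = e'] (mod (p - 1))" "e > 0" "e' > 0"
  shows "[int r ^ e = int r ^ e'] (mod int p)"
proof (cases "p dvd r")
  case True
  then have "int p dvd int r ^ e" "int p dvd int r ^ e'"
    using assms by (auto intro: dvd_power_le[of _ _ 1, simplified])
  then show ?thesis by (simp add: cong_iff_dvd_diff)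
next
  case False
  have *: "[int r ^ (b + (p - 1) * k) = int r ^ b] (mod int p)" for b k
  proof -
    have "[int r ^ (p - 1) = 1] (mod int p)"
      using fermat_theorem[OF prime_p False] by (metis cong_int_iff of_nat_1 of_nat_power)
    from cong_mult[OF cong_refl cong_pow[OF this, of k], of "int r ^ b"] show ?thesis
      by (simp add: power_add power_mult)
  qed
  obtain k l where "e + (p - 1) * k = e' + (p - 1) * l"
    using assms(1) by (metis cong_iff_lin_nat mult.commute)
  then show ?thesis
    using *[of e k] *[of e' l] by (metis cong_sym cong_trans)
qed

text \<open>Neighbouring entries of row \<open>p - 1\<close> of Pascal's triangle add up to an inner entry of row \<open>p\<close>,
a multiple of \<open>p\<close>.\<close>

lemma binomial_p_minus_1: "k \<le> p - 1 \<Longrightarrow> [int ((p - 1) choose k) = (-1) ^ k] (mod int p)"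
proof (induction k)
  case (Suc k)
  have "(p choose Suc k) = ((p - 1) choose k) + ((p - 1) choose Suc k)"
    using p_ge_3 binomial_Suc_Suc[of "p - 1" k] by simp
  moreover have "p dvd (p choose Suc k)"
    using Suc.prems p_ge_3 by (intro dvd_choose_prime prime_p) auto
  ultimately have "int p dvd int ((p - 1) choose Suc k) + int ((p - 1) choose k)"
    by (metis add.commute of_nat_add of_nat_dvd_iff)
  then have "[int ((p - 1) choose Suc k) = - int ((p - 1) choose k)] (mod int p)"
    by (simp only: cong_iff_dvd_diff diff_minus_eq_add)
  also have "[- int ((p - 1) choose k) = (-1) ^ Suc k] (mod int p)"
    using Suc by (simp add: cong_minus_minus_iff)
  finally show ?case .
qed simp

section \<open>Sums over triples\<close>

definition pharm :: "nat \<Rightarrow> int" where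
  "pharm n = (\<Sum>j<n. pinv j)"

definition pconv :: "nat \<Rightarrow> int" where
  "pconv s = (\<Sum>j\<in>{1..<s}. pinv j * pinv (s - j))"

lemma pharm_eq_sum_from_1: "pharm s = (\<Sum>j\<in>{1..<s}. pinv j)"
  unfolding pharm_def by (intro sum.mono_neutral_right) (auto simp: Suc_le_eq)

lemma card_multiples:
  assumes "\<not> p dvd s"
  shows "card {j \<in> {1..<s}. p dvd j} = s div p"
proof -
  have "{j \<in> {1..<s}. p dvd j} = (\<lambda>t. p * t) ` {1..s div p}"
  proof (intro equalityI subsetI)
    fix j assume "j \<in> {j \<in> {1..<s}. p dvd j}"
    then obtain t where "j = p * t" "1 \<le> j" "j < s" by auto
    moreover from this have "t \<le> s div p"
      using p_ge_3 by (simp add: less_eq_div_iff_mult_less_eq mult.commute)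
    ultimately show "j \<in> (\<lambda>t. p * t) ` {1..s div p}"
      by (intro image_eqI[of _ _ t]) (auto simp: Suc_le_eq)
  next
    fix j assume "j \<in> (\<lambda>t. p * t) ` {1..s div p}"
    then obtain t where t: "j = p * t" "1 \<le> t" "t \<le> s div p" by (elim imageE) (metis atLeastAtMost_iff)
    then have "j \<le> s"
      using p_ge_3 by (simp add: less_eq_div_iff_mult_less_eq mult.commute)
    moreover have "j \<noteq> s" using t assms by auto
    ultimately show "j \<in> {j \<in> {1..<s}. p dvd j}"
      using t p_ge_3 by auto
  qed
  moreover have "inj_on (\<lambda>t. p * t) {1..s div p}"
    using p_ge_3 by (auto simp: inj_on_def)
  ultimately show ?thesis by (simp add: card_image)
qed

text \<open>The identity \<open>1/(jk) = (1/j + 1/k)/(j + k)\<close>. If \<open>p\<close> divides \<open>j\<close>, the left-hand side is \<open>0\<close> while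
\<open>pinv k = pinv (j + k)\<close> makes the main term \<open>pinv (j + k) ^ 2\<close>; the correction removes it.\<close>

lemma pinv_partial_fraction:
  assumes "\<not> p dvd j + k"
  shows "[pinv j * pinv k = pinv (j + k) * (pinv j + pinv k)
     - pinv (j + k) ^ 2 * (of_bool (p dvd j) + of_bool (p dvd k))] (mod int p)"
proof -
  consider "p dvd j" "\<not> p dvd k" | "p dvd k" "\<not> p dvd j" | "\<not> p dvd j" "\<not> p dvd k"
    using assms dvd_add by blast
  then show ?thesis
  proof cases
    case 1
    have "[pinv (j + k) = pinv k] (mod int p)"
      using 1 by (intro pinv_cong) (simp add: cong_def mod_add_eq[symmetric])
    then obtain a where a: "pinv k = pinv (j + k) + int p * a" by (auto simp: cong_iff_lin)
    obtain b where b: "pinv j = int p * b"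
      using pinv_dvd[OF 1(1)] by (auto simp: cong_0_iff)
    show ?thesis
      unfolding cong_iff_dvd_diff a b using 1
      by (auto simp: algebra_simps power2_eq_square intro!: dvd_add dvd_diff)
  next
    case 2
    have "[pinv (j + k) = pinv j] (mod int p)"
      using 2 by (intro pinv_cong) (simp add: cong_def mod_add_eq[symmetric])
    then obtain a where a: "pinv j = pinv (j + k) + int p * a" by (auto simp: cong_iff_lin)
    obtain b where b: "pinv k = int p * b"
      using pinv_dvd[OF 2(1)] by (auto simp: cong_0_iff)
    show ?thesis
      unfolding cong_iff_dvd_diff a b using 2
      by (auto simp: algebra_simps power2_eq_square intro!: dvd_add dvd_diff)
  next
    case 3
    obtain a where a: "int j * pinv j = 1 + int p * a"
      using pinv_inverse[OF 3(1)] by (rule cong_imp_add_mult)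
    obtain b where b: "int k * pinv k = 1 + int p * b"
      using pinv_inverse[OF 3(2)] by (rule cong_imp_add_mult)
    obtain c where c: "(int j + int k) * pinv (j + k) = 1 + int p * c"
      using pinv_inverse[OF assms] by (metis cong_iff_lin cong_sym of_nat_add)
    have "(1 + int p * c) * (pinv j * pinv k) =
        pinv (j + k) * (int j * pinv j * pinv k + int k * pinv k * pinv j)"
      unfolding c[symmetric] by (simp add: algebra_simps)
    also have "\<dots> = pinv (j + k) * ((1 + int p * a) * pinv k + (1 + int p * b) * pinv j)"
      by (simp only: a b)
    finally have "pinv j * pinv k - pinv (j + k) * (pinv j + pinv k) =
        int p * (pinv (j + k) * (a * pinv k + b * pinv j) - c * (pinv j * pinv k))"
      by (simp add: algebra_simps)
    then show ?thesis
      using 3 by (simp add: cong_iff_dvd_diff)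
  qed
qed

text \<open>Summation of the partial fractions over \<open>j + k = s\<close>. The correction terms count the multiples of
\<open>p\<close> below \<open>s\<close>, which brings in \<open>s div p\<close>. This is the only source of the floor function in the
whole computation. After multiplication by \<open>pinv s\<close> the congruence also holds, trivially, for the
multiples \<open>s\<close> of \<open>p\<close>.\<close>

lemma pinv_mult_pconv:
  "[pinv s * pconv s = 2 * (pinv s ^ 2 * pharm s) - 2 * (pinv s ^ 3 * int (s div p))] (mod int p)"
proof (cases "p dvd s")
  case True
  then obtain b where "pinv s = int p * b"
    using pinv_dvd by (auto simp: cong_0_iff)
  then show ?thesis
    by (simp add: cong_iff_dvd_diff power2_eq_square power3_eq_cube)
next
  case False
  have bool_sum: "(\<Sum>j\<in>{1..<s}. of_bool (p dvd j)) = int (s div p)"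
    using card_multiples[OF False] by (simp add: of_bool_def sum.If_cases Int_def)
  have reflect: "(\<Sum>j\<in>{1..<s}. f (s - j)) = (\<Sum>j\<in>{1..<s}. f j)" for f :: "nat \<Rightarrow> int"
    by (rule sum.reindex_bij_witness[of _ "\<lambda>j. s - j" "\<lambda>j. s - j"]) auto
  have "[pconv s = (\<Sum>j\<in>{1..<s}. pinv s * (pinv j + pinv (s - j))
      - pinv s ^ 2 * (of_bool (p dvd j) + of_bool (p dvd s - j)))] (mod int p)"
    unfolding pconv_def
  proof (rule cong_sum)
    fix j assume "j \<in> {1..<s}"
    then show "[pinv j * pinv (s - j) = pinv s * (pinv j + pinv (s - j))
      - pinv s ^ 2 * (of_bool (p dvd j) + of_bool (p dvd s - j))] (mod int p)"
      using pinv_partial_fraction[of j "s - j"] False by simp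
  qed
  also have "(\<Sum>j\<in>{1..<s}. pinv s * (pinv j + pinv (s - j))
      - pinv s ^ 2 * (of_bool (p dvd j) + of_bool (p dvd s - j))) =
      pinv s * (pharm s + pharm s) - pinv s ^ 2 * (int (s div p) + int (s div p))"
    using reflect[of pinv] reflect[of "\<lambda>j. of_bool (p dvd j)"] bool_sum
    by (simp add: sum_subtractf sum.distrib pharm_eq_sum_from_1 flip: sum_distrib_left)
  finally have "[pinv s * pconv s = pinv s * (pinv s * (pharm s + pharm s)
      - pinv s ^ 2 * (int (s div p) + int (s div p)))] (mod int p)"
    by (rule cong_scalar_left)
  then show ?thesis
    by (simp add: algebra_simps power2_eq_square power3_eq_cube)
qed

definition triples :: "nat \<Rightarrow> (nat \<times> nat \<times> nat) set" where
  "triples n = {(i, j, k). i + j + k = n \<and> 0 < i \<and> 0 < j \<and> 0 < k}"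

lemma finite_triples: "finite (triples n)"
  by (rule finite_subset[of _ "{..n} \<times> {..n} \<times> {..n}"]) (auto simp: triples_def)

lemma sum_triples_pinv:
  "(\<Sum>(i, j, k)\<in>triples n. h i * (pinv i * pinv j * pinv k)) =
     (\<Sum>i\<in>{1..<n}. h i * pinv i * pconv (n - i))"
proof -
  have "(\<Sum>i\<in>{1..<n}. h i * pinv i * pconv (n - i)) =
      (\<Sum>(i, j)\<in>(SIGMA i:{1..<n}. {1..<n - i}). h i * pinv i * (pinv j * pinv (n - i - j)))"
    by (simp add: pconv_def sum_distrib_left sum.Sigma)
  also have "\<dots> = (\<Sum>(i, j, k)\<in>triples n. h i * (pinv i * pinv j * pinv k))"
    by (rule sum.reindex_bij_witness[of _ "\<lambda>(i, j, k). (i, j)" "\<lambda>(i, j). (i, j, n - i - j)"])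
      (auto simp: triples_def mult_ac)
  finally show ?thesis ..
qed

text \<open>Since \<open>p\<close> divides \<open>n\<close>, the index \<open>i = n - s\<close> has \<open>pinv i = - pinv s\<close>, where \<open>s = j + k\<close>. The sum
over triples is thus \<open>- (\<Sum>s. h s * (pinv s * pconv s))\<close>. The weight \<open>h\<close> will be constant or the
indicator function of the multiples of \<open>q\<close>.\<close>

lemma sum_triples_eq_sum_pharm:
  assumes "p dvd n" and sym: "\<And>i. i \<in> {1..<n} \<Longrightarrow> h (n - i) = h i"
  shows "[(\<Sum>(i, j, k)\<in>triples n. h i * (pinv i * pinv j * pinv k)) =
     - 2 * (\<Sum>s<n. h s * (pinv s ^ 2 * pharm s))
     + 2 * (\<Sum>s<n. h s * (pinv s ^ 3 * int (s div p)))] (mod int p)"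
proof -
  have "(\<Sum>(i, j, k)\<in>triples n. h i * (pinv i * pinv j * pinv k)) =
      (\<Sum>s\<in>{1..<n}. h s * (pinv (n - s) * pconv s))"
    unfolding sum_triples_pinv
    by (rule sum.reindex_bij_witness[of _ "\<lambda>j. n - j" "\<lambda>j. n - j"]) (auto simp: sym)
  also have "[\<dots> = (\<Sum>s\<in>{1..<n}. h s *
      (- (2 * (pinv s ^ 2 * pharm s) - 2 * (pinv s ^ 3 * int (s div p)))))] (mod int p)"
  proof (intro cong_sum cong_scalar_left)
    fix s assume "s \<in> {1..<n}"
    then have "[pinv (n - s) = - pinv s] (mod int p)"
      using assms(1) by (intro pinv_neg) simp
    then have "[pinv (n - s) * pconv s = - (pinv s * pconv s)] (mod int p)"
      using cong_scalar_right by fastforce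
    also have "[- (pinv s * pconv s) =
        - (2 * (pinv s ^ 2 * pharm s) - 2 * (pinv s ^ 3 * int (s div p)))] (mod int p)"
      using pinv_mult_pconv[of s] by (simp only: cong_minus_minus_iff)
    finally show "[pinv (n - s) * pconv s =
        - (2 * (pinv s ^ 2 * pharm s) - 2 * (pinv s ^ 3 * int (s div p)))] (mod int p)" .
  qed
  also have "(\<Sum>s\<in>{1..<n}. h s *
      (- (2 * (pinv s ^ 2 * pharm s) - 2 * (pinv s ^ 3 * int (s div p))))) =
      (\<Sum>s<n. h s * (- (2 * (pinv s ^ 2 * pharm s) - 2 * (pinv s ^ 3 * int (s div p)))))"
    by (rule sum.mono_neutral_left) (auto simp: Suc_le_eq)
  also have "\<dots> = - 2 * (\<Sum>s<n. h s * (pinv s ^ 2 * pharm s))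
     + 2 * (\<Sum>s<n. h s * (pinv s ^ 3 * int (s div p)))"
    by (simp add: sum_distrib_left sum.distrib[symmetric] algebra_simps sum_subtractf sum_negf)
  finally show ?thesis .
qed

lemma sum_triples_swap:
  fixes f :: "nat \<Rightarrow> nat \<Rightarrow> nat \<Rightarrow> int"
  shows "(\<Sum>(i, j, k)\<in>triples n. f j i k) = (\<Sum>(i, j, k)\<in>triples n. f i j k)"
    and "(\<Sum>(i, j, k)\<in>triples n. f k j i) = (\<Sum>(i, j, k)\<in>triples n. f i j k)"
  by (rule sum.reindex_bij_witness[of _ "\<lambda>(i, j, k). (j, i, k)" "\<lambda>(i, j, k). (j, i, k)"];
      auto simp: triples_def)
    (rule sum.reindex_bij_witness[of _ "\<lambda>(i, j, k). (k, j, i)" "\<lambda>(i, j, k). (k, j, i)"];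
      auto simp: triples_def)

end

section \<open>Harmonic and floor sums modulo p\<close>

lemma sum_blocks:
  fixes f :: "nat \<Rightarrow> int"
  shows "(\<Sum>s<p * c. f s) = (\<Sum>t<c. \<Sum>r<p. f (p * t + r))"
proof -
  have "(\<Sum>r<p. f (p * t + r)) = sum f {t * p..<t * p + p}" for t
    using sum.shift_bounds_nat_ivl[of f 0 "t * p" p]
    by (simp add: atLeast0LessThan add.commute mult.commute)
  then show ?thesis
    using sum.nat_group[of f p c] by (simp add: mult.commute)
qed

context odd_prime
begin

definition hsum :: int where
  "hsum = (\<Sum>r<p. pinv r ^ 2 * pharm r)"

definition floor_sum :: "nat \<Rightarrow> int" where
  "floor_sum q = (\<Sum>t<p. pinv (q * t) ^ 3 * int (q * t div p))"

lemma sum_multiples_permute: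
  assumes "coprime q p"
  shows "(\<Sum>t<p. f (q * t mod p)) = (\<Sum>t<p. f t)"
proof -
  have "inj_on (\<lambda>t. q * t mod p) {..<p}"
    using cong_mult_lcancel_nat[OF assms] by (auto simp: inj_on_def cong_def)
  moreover have "(\<lambda>t. q * t mod p) ` {..<p} \<subseteq> {..<p}"
    using p_ge_3 by auto
  ultimately have "bij_betw (\<lambda>t. q * t mod p) {..<p} {..<p}"
    using endo_inj_surj[of "{..<p}"] by (auto simp: bij_betw_def)
  then show ?thesis by (rule sum.reindex_bij_betw)
qed
lemma sum_dvd_multiples:
  fixes f :: "nat \<Rightarrow> int"
  assumes "q > 0"
  shows "(\<Sum>s<p * q. of_bool (q dvd s) * f s) = (\<Sum>t<p. f (q * t))"
proof -
  have "(\<Sum>s<p * q. of_bool (q dvd s) * f s) = (\<Sum>s\<in>{s. s < p * q \<and> q dvd s}. f s)"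
    by (rule sum.mono_neutral_cong_right) auto
  also have "\<dots> = (\<Sum>t<p. f (q * t))"
    using assms by (intro sum.reindex_bij_witness[of _ "\<lambda>t. q * t" "\<lambda>s. s div q"]) auto
  finally show ?thesis .
qed

end

text \<open>An integral model of the Bernoulli numbers below index \<open>p - 1\<close>: \<open>\<beta> k / D\<close> stands for
\<open>bernoulli k\<close>, and \<open>D\<close> is invertible modulo \<open>p\<close>.\<close>

locale bernoulli_rep = odd_prime +
  fixes D :: int and \<beta> :: "nat \<Rightarrow> int"
  assumes coprime_D: "coprime D (int p)"
    and bernoulli_eq: "k < p - 1 \<Longrightarrow> of_int D * bernoulli k = of_int (\<beta> k)"
begin

lemma power_sum_int:
  assumes "m < p - 1"
  shows "int (Suc m) * (D * (\<Sum>i<n. int i ^ m)) =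
     (\<Sum>k\<le>m. int (Suc m choose k) * \<beta> k * int n ^ (Suc m - k))"
proof -
  have "rat_of_int (int (Suc m) * (D * (\<Sum>i<n. int i ^ m))) =
      of_int D * (of_nat (Suc m) * (\<Sum>i<n. of_nat i ^ m))"
    by (simp del: of_nat_Suc)
  also have "\<dots> = (\<Sum>k\<le>m. of_nat (Suc m choose k) * (of_int D * bernoulli k) * of_nat n ^ (Suc m - k))"
    unfolding power_sum_bernoulli unfolding sum_distrib_left by (simp only: mult_ac)
  also have "\<dots> = (\<Sum>k\<le>m. of_nat (Suc m choose k) * of_int (\<beta> k) * of_nat n ^ (Suc m - k))"
    using assms by (intro sum.cong) (auto simp: bernoulli_eq)
  also have "\<dots> = of_int (\<Sum>k\<le>m. int (Suc m choose k) * \<beta> k * int n ^ (Suc m - k))"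
    by (simp del: binomial_Suc_Suc)
  finally show ?thesis by (simp only: of_int_eq_iff)
qed

lemma coprime_Suc_p:
  assumes "m < p - 1"
  shows "coprime (int (Suc m)) (int p)"
proof -
  have "\<not> p dvd Suc m"
    using assms by (auto dest!: dvd_imp_le)
  then show ?thesis
    using prime_imp_coprime[OF prime_p] coprime_commute coprime_int_iff by blast
qed

text \<open>By Fermat the exponent may be reduced to a positive one below \<open>p - 1\<close>. Every term of Faulhaber's
formula at \<open>n = p\<close> then contains a factor \<open>p\<close>, and the coefficient \<open>m + 1\<close> on the left is
invertible.\<close>

lemma power_sum_cong_0:
  assumes "\<not> (p - 1) dvd e"
  shows "[(\<Sum>r<p. int r ^ e) = 0] (mod int p)"
proof -
  define m where "m = e mod (p - 1)"
  have m: "0 < m" "m < p - 1" "e > 0"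
    using assms p_ge_3 by (auto simp: m_def dvd_eq_mod_eq_0 intro!: Nat.gr0I)
  have "int p dvd int (Suc m) * (D * (\<Sum>r<p. int r ^ m))"
    unfolding power_sum_int[OF m(2)]
    by (intro dvd_sum dvd_mult dvd_power) auto
  moreover have "coprime (int p) (int (Suc m) * D)"
    using coprime_Suc_p[OF m(2)] coprime_D by (simp add: coprime_commute)
  ultimately have "int p dvd (\<Sum>r<p. int r ^ m)"
    by (metis coprime_dvd_mult_right_iff mult.assoc)
  moreover have "[(\<Sum>r<p. int r ^ e) = (\<Sum>r<p. int r ^ m)] (mod int p)"
    using m by (intro cong_sum power_cong_exponent) (auto simp: m_def cong_def)
  ultimately show ?thesis by (simp add: cong_0_iff cong_dvd_iff)
qed

lemma power_sum_cong_minus_1: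
  assumes "(p - 1) dvd e" "e > 0"
  shows "[(\<Sum>r<p. int r ^ e) = - 1] (mod int p)"
proof -
  have "[(\<Sum>r<p. int r ^ e) = (\<Sum>r<p. if r = 0 then 0 else 1)] (mod int p)"
  proof (rule cong_sum)
    fix r assume r: "r \<in> {..<p}"
    show "[int r ^ e = (if r = 0 then 0 else 1)] (mod int p)"
    proof (cases "r = 0")
      case False
      then have "\<not> p dvd r" using r by (auto dest: dvd_imp_le)
      then have "[int r ^ (p - 1) = 1] (mod int p)"
        using fermat_theorem[OF prime_p] by (metis cong_int_iff of_nat_1 of_nat_power)
      moreover obtain k where "e = (p - 1) * k" using assms(1) by blast
      ultimately show ?thesis
        using False cong_pow[of "int r ^ (p - 1)" 1 "int p" k] by (simp add: power_mult)
    qed (use assms in \<open>simp add: zero_power\<close>)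
  qed
  also have "(\<Sum>r<p. if r = 0 then 0 else 1 :: int) = int p - 1"
  proof -
    have "(\<Sum>r<p. if r = 0 then 0 else 1 :: int) = (\<Sum>r\<in>{1..<p}. 1)"
      by (rule sum.mono_neutral_cong_right) auto
    then show ?thesis using p_ge_3 by (simp add: of_nat_diff)
  qed
  also have "[int p - 1 = - 1] (mod int p)"
    by (simp add: cong_iff_dvd_diff)
  finally show ?thesis .
qed

text \<open>The sum of \<open>pinv\<close> over a full period is a power sum whose exponent \<open>p - 2\<close> is not a
multiple of \<open>p - 1\<close>, hence zero.\<close>

lemma pharm_periodic: "[pharm (p * t + r) = pharm r] (mod int p)"
proof -
  have "\<not> (p - 1) dvd (p - 2)"
    using p_ge_3 by (auto dest: dvd_imp_le)
  then have period: "[(\<Sum>r<p. pinv r) = 0] (mod int p)"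
    unfolding pinv_def by (rule power_sum_cong_0)
  have shift: "[pinv (p * u + j) = pinv j] (mod int p)" for u j
    by (intro pinv_cong) (simp add: cong_def)
  have "pharm (p * t + r) = (\<Sum>s<p * t. pinv s) + (\<Sum>j<r. pinv (p * t + j))"
    unfolding pharm_def by (induction r) auto
  also have "\<dots> = (\<Sum>u<t. \<Sum>j<p. pinv (p * u + j)) + (\<Sum>j<r. pinv (p * t + j))"
    by (simp only: sum_blocks)
  also have "[\<dots> = (\<Sum>u<t. \<Sum>j<p. pinv j) + (\<Sum>j<r. pinv j)] (mod int p)"
    by (intro cong_add cong_sum shift)
  also have "[(\<Sum>u<t. \<Sum>j<p. pinv j) + (\<Sum>j<r. pinv j) = (\<Sum>u<t. 0) + (\<Sum>j<r. pinv j)] (mod int p)"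
    using period by (intro cong_add cong_sum cong_refl)
  finally show ?thesis by (simp add: pharm_def)
qed

text \<open>Faulhaber's formula with exponent \<open>p - 2\<close> writes \<open>- pharm r\<close> as a polynomial in \<open>r\<close> with
coefficients \<open>\<plusminus> bernoulli k\<close>. Summing it against \<open>pinv r ^ 2\<close> yields power sums, and only the one
with \<open>k = p - 3\<close> has an exponent divisible by \<open>p - 1\<close>.\<close>

lemma hsum_bernoulli: "[D * hsum = \<beta> (p - 3)] (mod int p)"
proof -
  have p1: "p - 1 = Suc (p - 2)" using p_ge_3 by simp
  have "[- (D * pharm r) = (\<Sum>k\<le>p - 2. (-1) ^ k * \<beta> k * int r ^ (p - 1 - k))] (mod int p)" for r
  proof -
    have "[- (D * pharm r) = int (p - 1) * (D * pharm r)] (mod int p)"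
      using p_ge_3 by (simp add: cong_iff_dvd_diff of_nat_diff algebra_simps)
    also have "int (p - 1) * (D * pharm r) = (\<Sum>k\<le>p - 2. int ((p - 1) choose k) * \<beta> k * int r ^ (p - 1 - k))"
      using power_sum_int[of "p - 2" r] p1 p_ge_3 by (simp only: pharm_def pinv_def)
    also have "[\<dots> = (\<Sum>k\<le>p - 2. (-1) ^ k * \<beta> k * int r ^ (p - 1 - k))] (mod int p)"
      using p_ge_3 by (intro cong_sum cong_mult cong_refl binomial_p_minus_1) auto
    finally show ?thesis .
  qed
  moreover have monomial: "pinv r ^ 2 * (c * int r ^ n) = c * int r ^ (2 * (p - 2) + n)" for r c n
  proof -
    have "pinv r ^ 2 = int r ^ (2 * (p - 2))"
      by (simp only: pinv_def power_mult[symmetric] mult.commute[of 2])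
    then show ?thesis by (simp only: power_add mult_ac)
  qed
  ultimately have "[(\<Sum>r<p. pinv r ^ 2 * - (D * pharm r)) =
      (\<Sum>r<p. pinv r ^ 2 * (\<Sum>k\<le>p - 2. (-1) ^ k * \<beta> k * int r ^ (p - 1 - k)))] (mod int p)"
    by (intro cong_sum cong_scalar_left)
  also have "(\<Sum>r<p. pinv r ^ 2 * (\<Sum>k\<le>p - 2. (-1) ^ k * \<beta> k * int r ^ (p - 1 - k))) =
      (\<Sum>k\<le>p - 2. (-1) ^ k * \<beta> k * (\<Sum>r<p. int r ^ (2 * (p - 2) + (p - 1 - k))))"
    unfolding sum_distrib_left by (subst sum.swap) (simp only: monomial)
  also have "[\<dots> = (\<Sum>k\<le>p - 2. if k = p - 3 then - \<beta> k else 0)] (mod int p)"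
  proof (rule cong_sum)
    fix k assume k: "k \<in> {..p - 2}"
    \<comment> \<open>By this identity \<open>p - 1\<close> divides the exponent iff it divides \<open>k + 2\<close>, which lies between \<open>2\<close> and \<open>p\<close>.\<close>
    have exponent: "2 * (p - 2) + (p - 1 - k) + (k + 2) = (p - 1) * 3"
      using k p_ge_3 by auto
    show "[(-1) ^ k * \<beta> k * (\<Sum>r<p. int r ^ (2 * (p - 2) + (p - 1 - k))) =
        (if k = p - 3 then - \<beta> k else 0)] (mod int p)"
    proof (cases "k = p - 3")
      case True
      then have "(p - 1) dvd (2 * (p - 2) + (p - 1 - k))"
        using p_ge_3 by (intro dvdI[of _ _ 2]) auto
      then have "[(\<Sum>r<p. int r ^ (2 * (p - 2) + (p - 1 - k))) = - 1] (mod int p)"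
        using p_ge_3 by (intro power_sum_cong_minus_1) auto
      moreover have "even k" using True odd_p p_ge_3 by simp
      ultimately show ?thesis
        using True cong_scalar_left[of _ "-1" "int p" "(-1) ^ k * \<beta> k"] by simp
    next
      case False
      have "\<not> (p - 1) dvd (k + 2)"
      proof
        assume "(p - 1) dvd (k + 2)"
        then obtain c where c: "k + 2 = (p - 1) * c" by blast
        have "c \<noteq> 0" "c \<noteq> 1" using c False p_ge_3 by (auto intro!: Nat.gr0I)
        then have "(p - 1) * 2 \<le> k + 2" unfolding c by (intro mult_le_mono2) auto
        \<comment> \<open>Twice \<open>p - 1\<close> can only fit below \<open>p\<close> for \<open>p = 3\<close>, and then \<open>k + 2 = 3\<close> is odd.\<close>
        then have "k = p - 2" "p = 3 \<or> p < 3" using k p_ge_3 by auto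
        then have "p = 3" "k = 1" using p_ge_3 by auto
        then show False using c by presburger
      qed
      then have "\<not> (p - 1) dvd (2 * (p - 2) + (p - 1 - k))"
        using exponent by (metis dvd_add_right_iff dvd_triv_left)
      then show ?thesis
        using False cong_scalar_left[OF power_sum_cong_0, of _ "(-1) ^ k * \<beta> k"] by simp
    qed
  qed
  also have "(\<Sum>k\<le>p - 2. if k = p - 3 then - \<beta> k else 0) = - \<beta> (p - 3)"
    using p_ge_3 by (simp add: diff_le_mono2)
  also have "(\<Sum>r<p. pinv r ^ 2 * - (D * pharm r)) = - (D * hsum)"
    by (simp add: hsum_def sum_distrib_left sum_negf mult_ac)
  finally show ?thesis by (simp only: cong_minus_minus_iff)
qed

text \<open>All terms of Faulhaber's formula at \<open>n = p\<close> but the last contain \<open>p ^ 2\<close>.\<close>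

lemma power_sum_cong_square:
  assumes "0 < m" "m < p - 1"
  shows "[D * (\<Sum>i<p. int i ^ m) = int p * \<beta> m] (mod int p ^ 2)"
proof -
  have "int (Suc m) * (D * (\<Sum>i<p. int i ^ m)) - int (Suc m) * (int p * \<beta> m) =
      (\<Sum>k<m. int (Suc m choose k) * \<beta> k * int p ^ (Suc m - k))"
    unfolding power_sum_int[OF assms(2)]
    by (simp add: sum.atMost_Suc lessThan_Suc_atMost[symmetric] del: binomial_Suc_Suc of_nat_Suc)
  moreover have "int p ^ 2 dvd \<dots>"
    by (intro dvd_sum dvd_mult le_imp_power_dvd) auto
  ultimately have "[int (Suc m) * (D * (\<Sum>i<p. int i ^ m)) = int (Suc m) * (int p * \<beta> m)] (mod int p ^ 2)"
    by (simp only: cong_iff_dvd_diff)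
  moreover have "coprime (int (Suc m)) (int p ^ 2)"
    using coprime_Suc_p[OF assms(2)] by simp
  ultimately show ?thesis
    by (simp only: cong_mult_lcancel)
qed

lemma power_add_mult_cong_square:
  fixes r f :: int
  assumes "0 < m"
  shows "[(r + int p * f) ^ m = r ^ m + int p * (int m * f * r ^ (m - 1))] (mod int p ^ 2)"
proof -
  have "[(r + int p * f) ^ Suc n = r ^ Suc n + int p * (int (Suc n) * f * r ^ n)] (mod int p ^ 2)" for n
  proof (induction n)
    case (Suc n)
    obtain a where a: "(r + int p * f) ^ Suc n = r ^ Suc n + int p * (int (Suc n) * f * r ^ n) + int p ^ 2 * a"
      using Suc by (rule cong_imp_add_mult)
    have "(r + int p * f) ^ Suc (Suc n) - (r ^ Suc (Suc n) + int p * (int (Suc (Suc n)) * f * r ^ Suc n)) =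
        int p ^ 2 * (f * (int (Suc n) * f * r ^ n) + (r + int p * f) * a)"
      unfolding power_Suc[of "r + int p * f" "Suc n"] a
      by (simp add: algebra_simps power2_eq_square)
    then show ?case by (simp only: cong_iff_dvd_diff dvd_triv_left)
  qed simp
  from this[of "m - 1"] show ?thesis using assms by simp
qed

text \<open>Voronoi's congruence. Put \<open>q t = r + p f\<close> with \<open>r = q t mod p\<close> and \<open>f = q t div p\<close>. Modulo
\<open>p ^ 2\<close> the \<open>m\<close>-th power of this is \<open>r ^ m + p m f r ^ (m - 1)\<close>. Summed over \<open>t\<close>, the numbers \<open>r\<close> run
through all residues, so \<open>q ^ m - 1\<close> times the full power sum equals \<open>p m\<close> times the sum of the
\<open>f r ^ (m - 1)\<close>. The full power sum is \<open>p * bernoulli m\<close> modulo \<open>p ^ 2\<close>, and one factor \<open>p\<close>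
cancels.\<close>

lemma voronoi_power:
  assumes "coprime q p" "0 < m" "m < p - 1"
  shows "[(int q ^ m - 1) * \<beta> m =
     D * (int m * (\<Sum>t<p. int (q * t div p) * int (q * t mod p) ^ (m - 1)))] (mod int p)"
proof -
  define V where "V = (\<Sum>t<p. int (q * t div p) * int (q * t mod p) ^ (m - 1))"
  define S where "S = (\<Sum>t<p. int t ^ m)"
  have "[(\<Sum>t<p. int (q * t) ^ m) =
      (\<Sum>t<p. int (q * t mod p) ^ m + int p * (int m * int (q * t div p) * int (q * t mod p) ^ (m - 1)))] (mod int p ^ 2)"
  proof (rule cong_sum)
    fix t
    have "int (q * t) = int (q * t mod p) + int p * int (q * t div p)"
      unfolding of_nat_mult[symmetric] of_nat_add[symmetric] by simp
    then show "[int (q * t) ^ m = int (q * t mod p) ^ m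
        + int p * (int m * int (q * t div p) * int (q * t mod p) ^ (m - 1))] (mod int p ^ 2)"
      using power_add_mult_cong_square[OF assms(2)] by simp
  qed
  moreover have "(\<Sum>t<p. int (q * t) ^ m) = int q ^ m * S"
    by (simp add: S_def sum_distrib_left power_mult_distrib)
  moreover have "(\<Sum>t<p. int (q * t mod p) ^ m + int p * (int m * int (q * t div p) * int (q * t mod p) ^ (m - 1))) =
      S + int p * (int m * V)"
    using sum_multiples_permute[OF assms(1), of "\<lambda>r. int r ^ m"]
    by (simp add: S_def V_def sum.distrib sum_distrib_left mult.assoc)
  ultimately have "[int q ^ m * S = S + int p * (int m * V)] (mod int p ^ 2)"
    by simp
  then obtain a where a: "int q ^ m * S = S + int p * (int m * V) + int p ^ 2 * a"
    by (rule cong_imp_add_mult)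
  obtain b where b: "D * S = int p * \<beta> m + int p ^ 2 * b"
    using power_sum_cong_square[OF assms(2,3)] unfolding S_def by (rule cong_imp_add_mult)
  have "int p * ((int q ^ m - 1) * \<beta> m - D * (int m * V)) =
      (int q ^ m - 1) * (int p * \<beta> m) - D * (int p * (int m * V))"
    by (simp add: algebra_simps)
  also have "int p * \<beta> m = D * S - int p ^ 2 * b"
    using b by simp
  also have "int p * (int m * V) = int q ^ m * S - S - int p ^ 2 * a"
    using a by simp
  also have "(int q ^ m - 1) * (D * S - int p ^ 2 * b) - D * (int q ^ m * S - S - int p ^ 2 * a) =
      int p * (int p * (D * a - (int q ^ m - 1) * b))"
    by (simp add: algebra_simps power2_eq_square)
  finally have "int p * ((int q ^ m - 1) * \<beta> m - D * (int m * V)) =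
      int p * (int p * (D * a - (int q ^ m - 1) * b))" .
  then have "(int q ^ m - 1) * \<beta> m - D * (int m * V) = int p * (D * a - (int q ^ m - 1) * b)"
    using p_ge_3 by simp
  then show ?thesis by (simp only: cong_iff_dvd_diff dvd_triv_left V_def)
qed

text \<open>Voronoi's congruence for \<open>m = p - 3\<close>: modulo \<open>p\<close>, \<open>m\<close> is \<open>- 3\<close>,
\<open>r ^ (m - 1)\<close> is \<open>pinv r ^ 3\<close> and \<open>q ^ m\<close> is \<open>q ^ (- 2)\<close>. For \<open>p = 3\<close>, where \<open>m = 0\<close>,
both sides vanish modulo \<open>p\<close>.\<close>

lemma floor_sum_bernoulli:
  assumes "coprime q p"
  shows "[3 * (D * int q ^ 2 * floor_sum q) = (int q ^ 2 - 1) * \<beta> (p - 3)] (mod int p)"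
proof -
  have "\<not> p dvd q"
    using assms prime_p p_ge_3 by (metis coprime_absorb_right coprime_commute not_prime_unit)
  show ?thesis
  proof (cases "p = 3")
    case True
    have "[int q ^ (p - 1) = 1] (mod int p)"
      using fermat_theorem[OF prime_p \<open>\<not> p dvd q\<close>] by (metis cong_int_iff of_nat_1 of_nat_power)
    then have "int p dvd int q ^ 2 - 1"
      using True by (simp add: cong_iff_dvd_diff)
    moreover have "int p dvd 3" using True by simp
    ultimately show ?thesis
      unfolding cong_iff_dvd_diff by (metis dvd_diff dvd_mult2)
  next
    case False
    moreover have "p \<noteq> 4" using odd_p by auto
    ultimately have p5: "p \<ge> 5" using p_ge_3 by simp
    define V where "V = (\<Sum>t<p. int (q * t div p) * int (q * t mod p) ^ (p - 4))"
    have "[floor_sum q = V] (mod int p)"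
      unfolding floor_sum_def V_def
    proof (rule cong_sum)
      fix t
      have "[pinv (q * t) ^ 3 = pinv (q * t mod p) ^ 3] (mod int p)"
        by (intro cong_pow pinv_cong) (simp add: cong_def)
      also have "pinv (q * t mod p) ^ 3 = int (q * t mod p) ^ ((p - 2) * 3)"
        by (simp add: pinv_def power_mult)
      also have "[\<dots> = int (q * t mod p) ^ (p - 4)] (mod int p)"
      proof (rule power_cong_exponent)
        have "(p - 2) * 3 = (p - 4) + (p - 1) * 2" using p5 by simp
        then show "[(p - 2) * 3 = p - 4] (mod (p - 1))" by (simp add: cong_def)
      qed (use p5 in auto)
      finally show "[pinv (q * t) ^ 3 * int (q * t div p) =
          int (q * t div p) * int (q * t mod p) ^ (p - 4)] (mod int p)"
        by (metis cong_scalar_right mult.commute)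
    qed
    then obtain a where a: "floor_sum q = V + int p * a"
      by (rule cong_imp_add_mult)
    have "[(int q ^ (p - 3) - 1) * \<beta> (p - 3) = D * (int (p - 3) * V)] (mod int p)"
      using voronoi_power[OF assms, of "p - 3"] p5 by (simp add: V_def)
    then obtain b where "(int q ^ (p - 3) - 1) * \<beta> (p - 3) = D * (int (p - 3) * V) + int p * b"
      by (rule cong_imp_add_mult)
    then have b: "(int q ^ (p - 3) - 1) * \<beta> (p - 3) = D * ((int p - 3) * V) + int p * b"
      using p5 by (simp add: of_nat_diff)
    have "int q ^ (p - 1) = int q ^ 2 * int q ^ (p - 3)"
    proof -
      have "p - 1 = 2 + (p - 3)" using p5 by simp
      then show ?thesis by (simp only: power_add)
    qed
    moreover have "[int q ^ (p - 1) = 1] (mod int p)"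
      using fermat_theorem[OF prime_p \<open>\<not> p dvd q\<close>] by (metis cong_int_iff of_nat_1 of_nat_power)
    ultimately have "[int q ^ 2 * int q ^ (p - 3) = 1] (mod int p)"
      by simp
    then obtain c where c: "int q ^ 2 * int q ^ (p - 3) = 1 + int p * c"
      by (rule cong_imp_add_mult)
    have "int q ^ 2 * ((int q ^ (p - 3) - 1) * \<beta> (p - 3)) =
        (int q ^ 2 * int q ^ (p - 3) - int q ^ 2) * \<beta> (p - 3)"
      by (simp add: algebra_simps)
    then have "int q ^ 2 * (D * ((int p - 3) * V) + int p * b) =
        (1 + int p * c - int q ^ 2) * \<beta> (p - 3)"
      unfolding b c .
    then have "3 * (D * int q ^ 2 * floor_sum q) - (int q ^ 2 - 1) * \<beta> (p - 3) =
        int p * (3 * D * int q ^ 2 * a + D * int q ^ 2 * V + int q ^ 2 * b - c * \<beta> (p - 3))"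
      unfolding a by (simp add: algebra_simps)
    then show ?thesis by (simp only: cong_iff_dvd_diff dvd_triv_left)
  qed
qed

lemma sum_pharm_blocks:
  "[(\<Sum>s<p * c. pinv s ^ 2 * pharm s) = int c * hsum] (mod int p)"
proof -
  have "(\<Sum>s<p * c. pinv s ^ 2 * pharm s) = (\<Sum>t<c. \<Sum>r<p. pinv (p * t + r) ^ 2 * pharm (p * t + r))"
    by (rule sum_blocks)
  also have "[\<dots> = (\<Sum>t<c. \<Sum>r<p. pinv r ^ 2 * pharm r)] (mod int p)"
    by (intro cong_sum cong_mult cong_pow pinv_cong pharm_periodic) (simp add: cong_def)
  finally show ?thesis by (simp add: hsum_def)
qed

text \<open>On the block \<open>p t \<le> s < p t + p\<close> the floor is the constant \<open>t\<close>, and the cubes of the inverses of all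
residues add up to zero because \<open>p - 1\<close> is even and hence does not divide \<open>3\<close>.\<close>

lemma sum_floor_blocks:
  "[(\<Sum>s<p * c. pinv s ^ 3 * int (s div p)) = 0] (mod int p)"
proof -
  have "\<not> (p - 1) dvd (p - 2) * 3"
  proof
    assume *: "(p - 1) dvd (p - 2) * 3"
    have "(p - 2) * 3 + 3 = (p - 1) * 3" using p_ge_3 by simp
    then have "(p - 1) dvd 3" using * by (metis dvd_add_right_iff dvd_triv_left)
    moreover have "even (p - 1)" using odd_p by simp
    ultimately show False by (metis dvd_trans even_numeral odd_numeral)
  qed
  then have cubes: "[(\<Sum>r<p. pinv r ^ 3) = 0] (mod int p)"
    unfolding pinv_def power_mult[symmetric] by (rule power_sum_cong_0)
  have "(\<Sum>s<p * c. pinv s ^ 3 * int (s div p)) =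
      (\<Sum>t<c. \<Sum>r<p. pinv (p * t + r) ^ 3 * int ((p * t + r) div p))"
    by (rule sum_blocks)
  also have "\<dots> = (\<Sum>t<c. \<Sum>r<p. pinv (p * t + r) ^ 3 * int t)"
    by (intro sum.cong) auto
  also have "[\<dots> = (\<Sum>t<c. \<Sum>r<p. pinv r ^ 3 * int t)] (mod int p)"
    by (intro cong_sum cong_mult cong_pow pinv_cong cong_refl) (simp add: cong_def)
  also have "(\<Sum>t<c. \<Sum>r<p. pinv r ^ 3 * int t) = (\<Sum>t<c. (\<Sum>r<p. pinv r ^ 3) * int t)"
    by (simp add: sum_distrib_right)
  also have "[\<dots> = (\<Sum>t<c. 0 * int t)] (mod int p)"
    by (intro cong_sum cong_scalar_right cubes)
  finally show ?thesis by simp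
qed

text \<open>The summand depends only on \<open>q t\<close> modulo \<open>p\<close>, and multiplication by \<open>q\<close> permutes the residues. The
analogous sum with a floor has no such invariance and remains as \<open>floor_sum q\<close>.\<close>

lemma sum_pharm_multiples:
  assumes "coprime q p"
  shows "[(\<Sum>t<p. pinv (q * t) ^ 2 * pharm (q * t)) = hsum] (mod int p)"
proof -
  have "[(\<Sum>t<p. pinv (q * t) ^ 2 * pharm (q * t)) =
      (\<Sum>t<p. pinv (q * t mod p) ^ 2 * pharm (q * t mod p))] (mod int p)"
  proof (intro cong_sum cong_mult cong_pow pinv_cong)
    fix t
    show "[pharm (q * t) = pharm (q * t mod p)] (mod int p)"
      using pharm_periodic[of "q * t div p" "q * t mod p"] by simp
  qed (simp add: cong_def)
  also have "(\<Sum>t<p. pinv (q * t mod p) ^ 2 * pharm (q * t mod p)) = hsum"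
    unfolding hsum_def using sum_multiples_permute[OF assms, of "\<lambda>r. pinv r ^ 2 * pharm r"] .
  finally show ?thesis .
qed

section \<open>Inclusion and exclusion over the multiples of q\<close>

lemma sum_triples_all:
  "[(\<Sum>(i, j, k)\<in>triples (p * c). pinv i * pinv j * pinv k) = - 2 * int c * hsum] (mod int p)"
proof -
  have "[(\<Sum>(i, j, k)\<in>triples (p * c). pinv i * pinv j * pinv k) =
      - 2 * (\<Sum>s<p * c. pinv s ^ 2 * pharm s) + 2 * (\<Sum>s<p * c. pinv s ^ 3 * int (s div p))] (mod int p)"
    using sum_triples_eq_sum_pharm[of "p * c" "\<lambda>_. 1"] by simp
  also have "[- 2 * (\<Sum>s<p * c. pinv s ^ 2 * pharm s) + 2 * (\<Sum>s<p * c. pinv s ^ 3 * int (s div p)) =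
      - 2 * (int c * hsum) + 2 * 0] (mod int p)"
    by (intro cong_add cong_scalar_left sum_pharm_blocks sum_floor_blocks)
  finally show ?thesis by (simp add: mult.assoc)
qed

lemma sum_triples_one_multiple:
  assumes "coprime q p" "q > 0"
  shows "[(\<Sum>(i, j, k)\<in>triples (p * q). of_bool (q dvd i) * (pinv i * pinv j * pinv k)) =
     - 2 * hsum + 2 * floor_sum q] (mod int p)"
proof -
  have "q dvd p * q - i \<longleftrightarrow> q dvd i" if "i < p * q" for i
    using that by (metis dvd_diff_nat dvd_diffD1 dvd_triv_right less_imp_le)
  then have "[(\<Sum>(i, j, k)\<in>triples (p * q). of_bool (q dvd i) * (pinv i * pinv j * pinv k)) =
      - 2 * (\<Sum>s<p * q. of_bool (q dvd s) * (pinv s ^ 2 * pharm s))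
      + 2 * (\<Sum>s<p * q. of_bool (q dvd s) * (pinv s ^ 3 * int (s div p)))] (mod int p)"
    by (intro sum_triples_eq_sum_pharm) auto
  also have "- 2 * (\<Sum>s<p * q. of_bool (q dvd s) * (pinv s ^ 2 * pharm s))
      + 2 * (\<Sum>s<p * q. of_bool (q dvd s) * (pinv s ^ 3 * int (s div p))) =
      - 2 * (\<Sum>t<p. pinv (q * t) ^ 2 * pharm (q * t)) + 2 * floor_sum q"
    unfolding sum_dvd_multiples[OF assms(2)] floor_sum_def ..
  also have "[\<dots> = - 2 * hsum + 2 * floor_sum q] (mod int p)"
    by (intro cong_add cong_scalar_left sum_pharm_multiples assms cong_refl)
  finally show ?thesis .
qed

text \<open>Dividing the three entries by \<open>q\<close> leads back to the triples with sum \<open>p\<close>.\<close>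

lemma sum_triples_all_multiples:
  assumes "q > 0"
  shows "[(\<Sum>(i, j, k)\<in>triples (p * q). of_bool (q dvd i \<and> q dvd j \<and> q dvd k) * (pinv i * pinv j * pinv k)) =
     - 2 * (pinv q ^ 3 * hsum)] (mod int p)"
proof -
  have "(\<Sum>(i, j, k)\<in>triples (p * q). of_bool (q dvd i \<and> q dvd j \<and> q dvd k) * (pinv i * pinv j * pinv k)) =
      (\<Sum>(i, j, k)\<in>{(i, j, k). (i, j, k) \<in> triples (p * q) \<and> q dvd i \<and> q dvd j \<and> q dvd k}. pinv i * pinv j * pinv k)"
    by (rule sum.mono_neutral_cong_right) (auto simp: finite_triples)
  also have "\<dots> = (\<Sum>(i, j, k)\<in>triples p. pinv (q * i) * pinv (q * j) * pinv (q * k))"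
  proof (rule sum.reindex_bij_witness[of _ "\<lambda>(i, j, k). (q * i, q * j, q * k)" "\<lambda>(i, j, k). (i div q, j div q, k div q)"])
    fix x assume "x \<in> {(i, j, k). (i, j, k) \<in> triples (p * q) \<and> q dvd i \<and> q dvd j \<and> q dvd k}"
    then obtain i j k where x: "x = (q * i, q * j, q * k)" "(q * i, q * j, q * k) \<in> triples (p * q)"
      by (auto elim!: dvdE)
    then have "q * (i + j + k) = q * p"
      by (auto simp: triples_def algebra_simps)
    then have "i + j + k = p" using assms by simp
    then show "(case x of (i, j, k) \<Rightarrow> (i div q, j div q, k div q)) \<in> triples p"
      using x assms by (auto simp: triples_def)
  qed (use assms in \<open>auto simp: triples_def algebra_simps\<close>)
  also have "\<dots> = pinv q ^ 3 * (\<Sum>(i, j, k)\<in>triples p. pinv i * pinv j * pinv k)"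
    by (simp add: sum_distrib_left pinv_mult power3_eq_cube case_prod_unfold mult_ac)
  also have "[\<dots> = pinv q ^ 3 * (- 2 * hsum)] (mod int p)"
    using sum_triples_all[of 1] by (intro cong_scalar_left) simp
  finally show ?thesis by (simp add: mult_ac)
qed

text \<open>Inclusion and exclusion over the entries divisible by \<open>q\<close>. As the entries add up to a multiple of
\<open>q\<close>, two of them being divisible forces the third, so all intersections of at least two of the
three conditions coincide; together they count \<open>3 - 1 = 2\<close> times.\<close>

lemma sum_triples_coprime:
  assumes "coprime q p" "q > 0"
  shows "[(\<Sum>(i, j, k)\<in>triples (p * q). of_bool (\<not> q dvd i \<and> \<not> q dvd j \<and> \<not> q dvd k) * (pinv i * pinv j * pinv k)) =
     (6 - 2 * int q - 4 * pinv q ^ 3) * hsum - 6 * floor_sum q] (mod int p)"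
proof -
  let ?v = "\<lambda>i j k. pinv i * pinv j * pinv k"
  let ?T = "triples (p * q)"
  let ?S1 = "\<Sum>(i, j, k)\<in>?T. of_bool (q dvd i) * ?v i j k"
  let ?S3 = "\<Sum>(i, j, k)\<in>?T. of_bool (q dvd i \<and> q dvd j \<and> q dvd k) * ?v i j k"
  \<comment> \<open>The factors are permuted so that the three single conditions are instances of
  \<open>sum_triples_swap\<close>.\<close>
  have "(\<Sum>(i, j, k)\<in>?T. of_bool (\<not> q dvd i \<and> \<not> q dvd j \<and> \<not> q dvd k) * ?v i j k) =
      (\<Sum>(i, j, k)\<in>?T. ?v i j k - of_bool (q dvd i) * ?v i j k - of_bool (q dvd j) * ?v j i k
        - of_bool (q dvd k) * ?v k j i + 2 * (of_bool (q dvd i \<and> q dvd j \<and> q dvd k) * ?v i j k))"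
  proof (rule sum.cong)
    fix x assume "x \<in> ?T"
    then obtain i j k where x: "x = (i, j, k)" "i + j + k = p * q"
      by (auto simp: triples_def)
    have two: "q dvd c" if "q dvd a" "q dvd b" "a + b + c = p * q" for a b c
      using that by (metis dvd_add dvd_add_right_iff dvd_triv_right)
    have "q dvd k" if "q dvd i" "q dvd j" using two[of i j k] that x by simp
    moreover have "q dvd j" if "q dvd i" "q dvd k" using two[of i k j] that x by simp
    moreover have "q dvd i" if "q dvd j" "q dvd k" using two[of j k i] that x by simp
    ultimately show "(case x of (i, j, k) \<Rightarrow> of_bool (\<not> q dvd i \<and> \<not> q dvd j \<and> \<not> q dvd k) * ?v i j k) =
      (case x of (i, j, k) \<Rightarrow> ?v i j k - of_bool (q dvd i) * ?v i j k - of_bool (q dvd j) * ?v j i k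
        - of_bool (q dvd k) * ?v k j i + 2 * (of_bool (q dvd i \<and> q dvd j \<and> q dvd k) * ?v i j k))"
      unfolding x by (cases "q dvd i"; cases "q dvd j"; cases "q dvd k") (auto simp: mult_ac)
  qed simp
  also have "\<dots> = (\<Sum>(i, j, k)\<in>?T. ?v i j k) - ?S1
      - (\<Sum>(i, j, k)\<in>?T. of_bool (q dvd j) * ?v j i k)
      - (\<Sum>(i, j, k)\<in>?T. of_bool (q dvd k) * ?v k j i) + 2 * ?S3"
    unfolding case_prod_unfold sum.distrib sum_subtractf sum_distrib_left ..
  also have "\<dots> = (\<Sum>(i, j, k)\<in>?T. ?v i j k) - 3 * ?S1 + 2 * ?S3"
    using sum_triples_swap[of "\<lambda>i j k. of_bool (q dvd i) * ?v i j k" "p * q"] by simp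
  also have "[\<dots> = - 2 * int q * hsum - 3 * (- 2 * hsum + 2 * floor_sum q)
      + 2 * (- 2 * (pinv q ^ 3 * hsum))] (mod int p)"
    by (intro cong_add cong_diff cong_scalar_left sum_triples_all sum_triples_one_multiple
        sum_triples_all_multiples assms)
  also have "- 2 * int q * hsum - 3 * (- 2 * hsum + 2 * floor_sum q)
      + 2 * (- 2 * (pinv q ^ 3 * hsum)) = (6 - 2 * int q - 4 * pinv q ^ 3) * hsum - 6 * floor_sum q"
    by (simp add: algebra_simps)
  finally show ?thesis .
qed

end

section \<open>Congruences between rational numbers\<close>

text \<open>Membership of \<open>x\<close> in the ideal generated by \<open>p\<close> in the ring of rationals with denominator prime
to \<open>p\<close>.\<close>

definition p_divisible :: "nat \<Rightarrow> rat \<Rightarrow> bool" where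
  "p_divisible p x \<longleftrightarrow> (\<exists>a b. coprime b (int p) \<and> of_int b * x = of_int (int p * a))"

lemma p_divisible_0 [simp]: "p_divisible p 0"
  unfolding p_divisible_def by (rule exI[of _ 0], rule exI[of _ 1]) simp

lemma p_divisible_add:
  assumes "p_divisible p x" "p_divisible p y"
  shows "p_divisible p (x + y)"
proof -
  obtain a b c d where *: "coprime b (int p)" "of_int b * x = of_int (int p * a)"
    "coprime d (int p)" "of_int d * y = of_int (int p * c)"
    using assms unfolding p_divisible_def by blast
  have "of_int (b * d) * (x + y) = of_int d * (of_int b * x) + of_int b * (of_int d * y)"
    by (simp add: algebra_simps)
  also have "\<dots> = of_int (int p * (d * a + b * c))"
    unfolding *(2,4) by (simp add: algebra_simps)
  finally show ?thesis
    using *(1,3) unfolding p_divisible_def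
    by (intro exI[of _ "d * a + b * c"] exI[of _ "b * d"]) simp
qed

lemma p_divisible_sum:
  "(\<And>x. x \<in> A \<Longrightarrow> p_divisible p (f x)) \<Longrightarrow> p_divisible p (sum f A)"
  by (induction A rule: infinite_finite_induct) (auto intro: p_divisible_add)

text \<open>It is enough to clear denominators by any integers prime to \<open>m\<close>, because the reduced denominator
divides every such multiplier. That \<open>x\<close> has denominator prime to \<open>m\<close> is inherited from \<open>y\<close> and
\<open>x - y\<close>.\<close>

lemma rat_congI:
  assumes y: "coprime b (int m)" "of_int b * y = of_int a" and "p_divisible m (x - y)"
  shows "rat_cong x y m"
proof -
  have integral: "coprime (snd (quotient_of r)) (int m) \<and> (int m dvd c \<longrightarrow> int m dvd fst (quotient_of r))"
    if "coprime d (int m)" "of_int d * r = of_int c" for r c d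
  proof -
    obtain u v where uv: "quotient_of r = (u, v)" by (metis surj_pair)
    have r: "r = of_int u / of_int v" "v > 0" "coprime u v"
      using uv quotient_of_div quotient_of_denom_pos quotient_of_coprime by auto
    have "rat_of_int (d * u) = of_int (c * v)"
      using that(2) r by (simp add: field_simps)
    then have eq: "d * u = c * v" by (simp only: of_int_eq_iff)
    then have "v dvd d"
      using r(3) by (metis coprime_commute coprime_dvd_mult_left_iff dvd_triv_right)
    then have "coprime v (int m)"
      using that(1) by (metis coprime_divisors dvd_refl)
    moreover have "int m dvd u" if "int m dvd c"
    proof -
      have "int m dvd d * u" using that eq by simp
      then show ?thesis
        using \<open>coprime d (int m)\<close> by (metis coprime_commute coprime_dvd_mult_right_iff)
    qed
    ultimately show ?thesis by (simp add: uv)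
  qed
  obtain c d where cd: "coprime d (int m)" "of_int d * (x - y) = of_int (int m * c)"
    using assms(3) unfolding p_divisible_def by blast
  have "of_int (b * d) * x = of_int b * (of_int d * (x - y)) + of_int d * (of_int b * y)"
    by (simp add: algebra_simps)
  also have "\<dots> = of_int (b * (int m * c) + d * a)"
    unfolding cd y by simp
  finally have x: "of_int (b * d) * x = of_int (b * (int m * c) + d * a)" .
  have "coprime (b * d) (int m)" using y cd by simp
  then show ?thesis
    unfolding rat_cong_def using integral[OF _ x] integral[OF y] integral[OF cd] by simp
qed

context odd_prime
begin

lemma p_divisible_inverse_diff:
  assumes "\<not> p dvd a"
  shows "p_divisible p (1 / of_nat a - of_int (pinv a))"
proof -
  obtain c where c: "1 = int a * pinv a + int p * c"
    using pinv_inverse[OF assms] by (auto simp: cong_iff_lin)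
  have "a \<noteq> 0" using assms by (metis dvd_0_right)
  then have "of_int (int a) * (1 / of_nat a - of_int (pinv a)) = rat_of_int (1 - int a * pinv a)"
    by (simp add: field_simps)
  also have "1 - int a * pinv a = int p * c"
    using c by simp
  finally have "of_int (int a) * (1 / of_nat a - of_int (pinv a)) = rat_of_int (int p * c)" .
  moreover have "coprime (int a) (int p)"
    using prime_imp_coprime[OF prime_p assms] coprime_commute coprime_int_iff by blast
  ultimately show ?thesis unfolding p_divisible_def by blast
qed

lemma Z_index_prime_mult:
  assumes "prime q"
  shows "{(i, j, k). i + j + k = p * q \<and> i \<in> pos_coprime (p * q) \<and> j \<in> pos_coprime (p * q) \<and> k \<in> pos_coprime (p * q)} =
     {(i, j, k). (i, j, k) \<in> triples (p * q) \<and> (\<not> p dvd i \<and> \<not> p dvd j \<and> \<not> p dvd k)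
        \<and> (\<not> q dvd i \<and> \<not> q dvd j \<and> \<not> q dvd k)}"
proof -
  have "coprime i r \<longleftrightarrow> \<not> r dvd i" if "prime r" for i r :: nat
    using that by (metis coprime_absorb_right coprime_commute not_prime_unit prime_imp_coprime)
  then have "i \<in> pos_coprime (p * q) \<longleftrightarrow> 0 < i \<and> \<not> p dvd i \<and> \<not> q dvd i" for i
    using prime_p assms by (auto simp: pos_coprime_def)
  then show ?thesis by (auto simp: triples_def)
qed

text \<open>Each summand \<open>1/(ijk)\<close> of \<open>Z (p * q)\<close> is \<open>pinv (i * j * k)\<close> modulo \<open>p\<close>. The triples with an entry
divisible by \<open>p\<close>, absent from \<open>Z\<close>, contribute \<open>0\<close>.\<close>

lemma p_divisible_Z:
  assumes "prime q"
  shows "p_divisible p (Z (p * q) - of_int (\<Sum>(i, j, k)\<in>triples (p * q).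
     of_bool (\<not> q dvd i \<and> \<not> q dvd j \<and> \<not> q dvd k) * (pinv i * pinv j * pinv k)))"
proof -
  define w where "w = (\<lambda>(i, j, k). 1 / (of_nat i * of_nat j * of_nat k) :: rat)"
  define x where "x = (\<lambda>(i, j, k). of_bool (\<not> p dvd i \<and> \<not> p dvd j \<and> \<not> p dvd k) * w (i, j, k)
     - of_int (pinv i * pinv j * pinv k))"
  define g where "g = (\<lambda>(i, j, k). of_bool (\<not> q dvd i \<and> \<not> q dvd j \<and> \<not> q dvd k) :: rat)"
  have "p_divisible p (x t)" for t
  proof -
    obtain i j k where t: "t = (i, j, k)" by (metis surj_pair)
    show ?thesis
    proof (cases "p dvd i * j * k")
      case True
      then have "p dvd i \<or> p dvd j \<or> p dvd k"
        using prime_p by (simp add: prime_dvd_mult_iff)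
      moreover have "int p dvd pinv (i * j * k)"
        using pinv_dvd[OF True] by (simp add: cong_0_iff)
      then obtain c where "pinv i * pinv j * pinv k = int p * c"
        by (auto simp: pinv_mult)
      then have "of_int 1 * - rat_of_int (pinv i * pinv j * pinv k) = of_int (int p * - c)"
        by simp
      then have "p_divisible p (- rat_of_int (pinv i * pinv j * pinv k))"
        unfolding p_divisible_def by (intro exI[of _ "- c"] exI[of _ 1]) auto
      ultimately show ?thesis by (auto simp: x_def t)
    next
      case False
      then have "\<not> p dvd i \<and> \<not> p dvd j \<and> \<not> p dvd k" by auto
      then show ?thesis
        using p_divisible_inverse_diff[OF False] by (simp add: x_def w_def t pinv_mult)
    qed
  qed
  then have "p_divisible p (g t * x t)" for t
    by (auto simp: g_def split: prod.splits)
  then have "p_divisible p (\<Sum>t\<in>triples (p * q). g t * x t)"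
    by (intro p_divisible_sum)
  moreover have "Z (p * q) = (\<Sum>t\<in>triples (p * q). g t * (case t of (i, j, k) \<Rightarrow>
      of_bool (\<not> p dvd i \<and> \<not> p dvd j \<and> \<not> p dvd k) * w (i, j, k)))"
    unfolding Z_def Z_index_prime_mult[OF assms]
    by (rule sum.mono_neutral_cong_left) (auto simp: finite_triples g_def w_def)
  moreover have "of_int (\<Sum>(i, j, k)\<in>triples (p * q).
     of_bool (\<not> q dvd i \<and> \<not> q dvd j \<and> \<not> q dvd k) * (pinv i * pinv j * pinv k)) =
     (\<Sum>t\<in>triples (p * q). g t * (case t of (i, j, k) \<Rightarrow> of_int (pinv i * pinv j * pinv k)))"
    unfolding of_int_sum by (intro sum.cong) (auto simp: g_def)
  ultimately show ?thesis
    by (simp add: x_def sum_subtractf[symmetric] right_diff_distrib[symmetric] case_prod_unfold)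
qed

end

theorem theorem1:
  fixes p q :: nat
  assumes "prime p" and "prime q" and "odd p" and "odd q" and "p \<noteq> q"
  shows "rat_cong (Z (p * q))
           (2 * (2 - of_nat q) * (1 - 1 / of_nat q ^ 3) * bernoulli (p - 3)) p"
proof -
  obtain D \<beta> where "coprime D (int p)" "\<forall>k<p - 1. of_int D * bernoulli k = of_int (\<beta> k)"
    using bernoulli_common_denominator[OF assms(1)] by blast
  then interpret bernoulli_rep p D \<beta>
    using assms by unfold_locales auto
  let ?y = "2 * (2 - of_nat q) * (1 - 1 / of_nat q ^ 3) * bernoulli (p - 3)"
  define S where "S = (\<Sum>(i, j, k)\<in>triples (p * q).
     of_bool (\<not> q dvd i \<and> \<not> q dvd j \<and> \<not> q dvd k) * (pinv i * pinv j * pinv k))"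
  have "coprime q p" "q > 0" "\<not> p dvd q"
    using assms primes_coprime[of q p] prime_gt_0_nat primes_dvd_imp_eq by auto
  obtain a where a: "S = (6 - 2 * int q - 4 * pinv q ^ 3) * hsum - 6 * floor_sum q + int p * a"
    using sum_triples_coprime[OF \<open>coprime q p\<close> \<open>q > 0\<close>] unfolding S_def by (rule cong_imp_add_mult)
  obtain b where b: "D * hsum = \<beta> (p - 3) + int p * b"
    using hsum_bernoulli by (rule cong_imp_add_mult)
  obtain c where c: "3 * (D * int q ^ 2 * floor_sum q) = (int q ^ 2 - 1) * \<beta> (p - 3) + int p * c"
    using floor_sum_bernoulli[OF \<open>coprime q p\<close>] by (rule cong_imp_add_mult)
  have "[(int q * pinv q) ^ 3 = 1 ^ 3] (mod int p)"
    using pinv_inverse[OF \<open>\<not> p dvd q\<close>] by (rule cong_pow)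
  then obtain d where d: "int q ^ 3 * pinv q ^ 3 = 1 + int p * d"
    unfolding power_mult_distrib power_one by (rule cong_imp_add_mult)
  define E where "E = 2 * (2 - int q) * (int q ^ 3 - 1) * \<beta> (p - 3)"
  have y: "of_int (D * int q ^ 3) * ?y = of_int E"
  proof -
    have "of_int (D * int q ^ 3) * ?y =
        2 * (2 - of_nat q) * (of_nat q ^ 3 * (1 - 1 / of_nat q ^ 3)) * (of_int D * bernoulli (p - 3))"
      by (simp only: of_int_mult of_int_power of_int_of_nat_eq mult_ac)
    also have "of_int D * bernoulli (p - 3) = of_int (\<beta> (p - 3))"
      using p_ge_3 by (intro bernoulli_eq) simp
    also have "of_nat q ^ 3 * (1 - 1 / of_nat q ^ 3) = (of_nat q ^ 3 - 1 :: rat)"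
      using \<open>q > 0\<close> by (simp add: field_simps)
    finally show ?thesis by (simp add: E_def)
  qed
  have "D * int q ^ 3 * S = int q ^ 3 * (6 - 2 * int q) * (D * hsum)
      - 4 * (int q ^ 3 * pinv q ^ 3) * (D * hsum)
      - 2 * int q * (3 * (D * int q ^ 2 * floor_sum q)) + int p * (D * int q ^ 3 * a)"
    unfolding a by (simp add: algebra_simps power2_eq_square power3_eq_cube)
  also have "\<dots> = E + int p * (int q ^ 3 * (6 - 2 * int q) * b - 4 * b
      - 4 * d * (\<beta> (p - 3) + int p * b) - 2 * int q * c + D * int q ^ 3 * a)"
    unfolding b c d E_def by (simp add: algebra_simps power2_eq_square power3_eq_cube)
  finally obtain e where e: "D * int q ^ 3 * S = E + int p * e" by blast
  have coprime: "coprime (D * int q ^ 3) (int p)"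
    using coprime_D \<open>coprime q p\<close> by simp
  have "of_int (D * int q ^ 3) * (of_int S - ?y) = of_int (D * int q ^ 3) * of_int S - of_int (D * int q ^ 3) * ?y"
    by (rule right_diff_distrib)
  also have "\<dots> = of_int (D * int q ^ 3 * S - E)"
    unfolding y by simp
  also have "D * int q ^ 3 * S - E = int p * e" using e by simp
  finally have "p_divisible p (of_int S - ?y)"
    unfolding p_divisible_def using coprime by blast
  then have "p_divisible p ((Z (p * q) - of_int S) + (of_int S - ?y))"
    using p_divisible_Z[OF assms(2)] unfolding S_def by (rule p_divisible_add[rotated])
  then show ?thesis
    using coprime y by (intro rat_congI[of "D * int q ^ 3"]) auto
qed

end
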